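(* If $E(\lambda)$ is a $*$-palindromic $n\times n$ matrix pencil with $\operatorname{rank}E=r\leq n$, then it can be written as $$E(\lambda)=\big((a_1-b_1\mathfrak i)+\lambda(a_1+b_1\mathfrak i)\big)u_1u_1^*+\cdots+\big((a_\ell-b_\ell\mathfrak i)+\lambda(a_\ell+b_\ell\mathfrak i)\big)u_\ell u_\ell^*+v_1w_1^*+\cdots+v_sw_s^*+(\operatorname{rev}w_1)v_1^*+\cdots+(\operatorname{rev}w_s)v_s^*,$$ where $\mathfrak i$ is the imaginary unit, $a_i,b_i\in\mathbb R$ for $i=1,\dots,\ell$, $u_i,v_j,w_j\in\mathbb C[\lambda]^n$, and (i) $\ell+2s=r$; (ii) $\deg u_1=\cdots=\deg u_\ell=0=\deg v_1=\cdots=\deg v_s$ and $\deg w_1,\dots,\deg w_s\leq 1$.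
   Context: A matrix pencil $E(\lambda)=A+\lambda B$ with $A,B\in\mathbb C^{n\times n}$ is $*$-palindromic if $A^*=B$. Its rank is the normal rank, i.e. the rank as a matrix over the field of rational functions, $\max_{\lambda\in\mathbb C}\operatorname{rank}(A+\lambda B)$. For $v(\lambda)\in\mathbb C[\lambda]^n$, $\deg v$ is the largest degree of the entries of $v$; so $\deg v=0$ means that $v$ is a constant vector in $\mathbb C^n$. For $w(\lambda)=w_0+\lambda w_1$ with $w_0,w_1\in\mathbb C^n$, $w^*$ denotes $w_0^*+\lambda w_1^*$ (conjugate transpose is applied to coefficients only, not to $\lambda$) and $\operatorname{rev}w(\lambda)=w_1+\lambda w_0$. *)

theory Defs
  imports
    "HOL-Computational_Algebra.Computational_Algebra"
    "Jordan_Normal_Form.Schur_Decomposition"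
    "Jordan_Normal_Form.DL_Rank"
begin

definition pencil :: "complex mat \<Rightarrow> complex mat \<Rightarrow> complex poly mat" where
  "pencil A B = mat (dim_row A) (dim_col A) (\<lambda>(i, j). [:A $$ (i, j), B $$ (i, j):])"

definition star_palindromic :: "complex mat \<Rightarrow> complex mat \<Rightarrow> bool" where
  "star_palindromic A B \<longleftrightarrow> mat_adjoint A = B"

definition normal_rank :: "complex poly mat \<Rightarrow> nat" where
  "normal_rank P = vec_space.rank (dim_row P) (map_mat to_fract P)"

text \<open>The degree of the zero polynomial is 0 here, so degree 0 means exactly "constant vector",
  the zero vector included. The inserted 0 only matters for vectors of dimension 0.\<close>

definition vec_degree :: "complex poly vec \<Rightarrow> nat" where
  "vec_degree v = Max (insert 0 ((\<lambda>i. degree (v $ i)) ` {..<dim_vec v}))"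

text \<open>Conjugation acts on the coefficients only, the indeterminate is left fixed. As vectors carry
  no orientation, the row vector \<open>w\<^sup>*\<close> is represented by the list of its entries.\<close>

definition vec_star :: "complex poly vec \<Rightarrow> complex poly vec" where
  "vec_star w = map_vec (map_poly cnj) w"

text \<open>The column-times-row product \<open>x y\<^sup>*\<close>.\<close>

definition outer_star :: "complex poly vec \<Rightarrow> complex poly vec \<Rightarrow> complex poly mat" where
  "outer_star x y = mat (dim_vec x) (dim_vec y) (\<lambda>(i, j). x $ i * vec_star y $ j)"

text \<open>Reversal with respect to grade 1, whatever the actual degree: \<open>w\<^sub>0 + \<lambda> w\<^sub>1\<close> becomes
  \<open>w\<^sub>1 + \<lambda> w\<^sub>0\<close>, hence a constant \<open>w\<^sub>0\<close> becomes \<open>\<lambda> w\<^sub>0\<close>. Meaningful for \<open>vec_degree w \<le> 1\<close> only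
  (\<open>reflect_poly\<close> reverses with respect to the actual degree).\<close>

definition rev_vec :: "complex poly vec \<Rightarrow> complex poly vec" where
  "rev_vec w = map_vec (\<lambda>p. [:coeff p 1, coeff p 0:]) w"

end

theory Submission
  imports Defs "Jordan_Normal_Form.Spectral_Radius"
begin

text \<open>
  Since \<open>B = A\<^sup>\<dagger>\<close>, comparing coefficients of the indeterminate turns the claim into one about the
  single matrix \<open>A\<close>: it has to be a sum of \<open>l\<close> terms \<open>c u u\<^sup>\<dagger>\<close> (\<open>c\<close> complex, \<open>c = a - b \<i>\<close>) and of
  \<open>s\<close> terms \<open>v x\<^sup>\<dagger> + y v\<^sup>\<dagger>\<close> (where \<open>w = x + \<lambda> y\<close>). Call \<open>l + 2 s\<close> the weight of such a sum. As zero
  terms may be added, it suffices to find a sum of weight at most the normal rank. The predicate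
  \<open>star_sum\<close> describes the sums; they are preserved by congruence.

  The sum is built by induction on the dimension. In positive dimension, the complex matrix
  \<open>\<alpha> A + \<beta> A\<^sup>\<dagger>\<close> is singular for some \<open>(\<alpha>, \<beta>) \<noteq> 0\<close>, so there is \<open>x \<noteq> 0\<close> with \<open>A x\<close> and \<open>A\<^sup>\<dagger> x\<close> both multiples of one
  vector \<open>z\<close> (\<open>pencil_eigenvector\<close>).

  \<^item> If \<open>A x = A\<^sup>\<dagger> x = 0\<close>, then \<open>A\<close> lives on a complement of \<open>x\<close> (\<open>drop_kernel_vector\<close>).
  \<^item> Otherwise, if \<open>z\<^sup>\<dagger> x \<noteq> 0\<close>, the space is the direct sum of the line of \<open>x\<close> and the orthogonal
    complement of \<open>z\<close>, and both \<open>A\<close> and \<open>A\<^sup>\<dagger>\<close> are block diagonal with respect to it. One term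
    \<open>c u u\<^sup>\<dagger>\<close> splits off (\<open>nonisotropic_step\<close>).
  \<^item> Otherwise \<open>x\<close> lies in the orthogonal complement of \<open>z\<close>, and the form compressed to this
    complement has \<open>x\<close> in its kernel, so it lives in dimension \<open>n - 2\<close>. What the compression
    loses is \<open>z p\<^sup>\<dagger> + q z\<^sup>\<dagger>\<close> for some \<open>p, q\<close> (\<open>isotropic_step\<close>).

  The weight is controlled along the same induction from below: a nonzero minor of size \<open>k\<close> of the
  smaller pencil is bordered by one row and column in the second case, by two in the third
  (\<open>det_pencil_border\<close>), so the pencil of \<open>A\<close> always has a nonzero generalized minor whose size is
  the weight of the sum, and the normal rank is at least that size (\<open>minor_le_normal_rank\<close>).
\<close>

section \<open>Matrix products and adjoints\<close>

notation mat_adjoint ("(_\<^sup>\<dagger>)" [1000] 999)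

text \<open>Column vectors are \<open>n \<times> 1\<close> matrices and scalars \<open>1 \<times> 1\<close> matrices below, so that all computations
  are in matrix products; keeping \<open>1\<close> from becoming \<open>Suc 0\<close> keeps the dimensions recognizable.\<close>

declare One_nat_def [simp del]

lemma adjoint_dim [simp]: "dim_row (A\<^sup>\<dagger>) = dim_col A" "dim_col (A\<^sup>\<dagger>) = dim_row A"
  by (simp_all add: mat_adjoint_def)

lemma adjoint_carrier [simp, intro]: "A \<in> carrier_mat n m \<Longrightarrow> A\<^sup>\<dagger> \<in> carrier_mat m n"
  by auto

lemma adjoint_index [simp]:
  "i < dim_col A \<Longrightarrow> j < dim_row A \<Longrightarrow> A\<^sup>\<dagger> $$ (i, j) = conjugate (A $$ (j, i))"
  by (simp add: mat_adjoint_def mat_of_rows_index)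

lemma adjoint_adjoint [simp]: "(A\<^sup>\<dagger>)\<^sup>\<dagger> = A"
  by (rule eq_matI) auto

lemma adjoint_zero [simp]: "(0\<^sub>m n m)\<^sup>\<dagger> = 0\<^sub>m m n"
  by (rule eq_matI) auto

lemma adjoint_one [simp]: "(1\<^sub>m n)\<^sup>\<dagger> = (1\<^sub>m n :: complex mat)"
  by (rule eq_matI) auto

lemma adjoint_add:
  "dim_row A = dim_row B \<Longrightarrow> dim_col A = dim_col B \<Longrightarrow> (A + B)\<^sup>\<dagger> = A\<^sup>\<dagger> + B\<^sup>\<dagger>"
  by (rule eq_matI) (auto simp: conjugate_dist_add)

lemma adjoint_mult:
  assumes "dim_col A = dim_row B" shows "(A * B)\<^sup>\<dagger> = B\<^sup>\<dagger> * (A :: complex mat)\<^sup>\<dagger>"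
  using assms
  by (intro eq_matI) (auto simp: scalar_prod_def mult.commute intro!: sum.cong)

text \<open>With conditions on dimensions instead of carriers, the distributive and associative laws are
  conditional rewrite rules whose conditions the simplifier decides; they bring every expression in
  products, sums and adjoints into a normal form.\<close>

lemma mult_assoc_dims:
  fixes A :: "'a :: semiring_0 mat"
  shows "dim_col A = dim_row B \<Longrightarrow> dim_col B = dim_row C \<Longrightarrow> A * B * C = A * (B * C)"
  by (rule assoc_mult_mat) auto

lemma add_mult_dims:
  fixes A :: "'a :: semiring_0 mat"
  shows "dim_row A = dim_row B \<Longrightarrow> dim_col A = dim_col B \<Longrightarrow> dim_col A = dim_row C \<Longrightarrow>
    (A + B) * C = A * C + B * C"
  by (rule add_mult_distrib_mat) auto

lemma mult_add_dims:
  fixes A :: "'a :: semiring_0 mat"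
  shows "dim_row B = dim_row C \<Longrightarrow> dim_col B = dim_col C \<Longrightarrow> dim_col A = dim_row B \<Longrightarrow>
    A * (B + C) = A * B + A * C"
  by (rule mult_add_distrib_mat) auto

lemma add_assoc_dims:
  fixes A :: "'a :: semigroup_add mat"
  shows "dim_row A = dim_row B \<Longrightarrow> dim_col A = dim_col B \<Longrightarrow> dim_row B = dim_row C \<Longrightarrow> dim_col B = dim_col C \<Longrightarrow> A + B + C = A + (B + C)"
  by (intro eq_matI) (auto simp: add.assoc)

lemma add_zero_dims:
  fixes A :: "'a :: monoid_add mat"
  shows "dim_row A = n \<Longrightarrow> dim_col A = m \<Longrightarrow> A + 0\<^sub>m n m = A"
    and "dim_row A = n \<Longrightarrow> dim_col A = m \<Longrightarrow> 0\<^sub>m n m + A = A"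
  by (auto intro!: eq_matI)

lemmas mat_dims = mult_assoc_dims add_mult_dims mult_add_dims adjoint_mult adjoint_add add_assoc_dims add_zero_dims

section \<open>Sums of terms of weight one and two\<close>

text \<open>The second argument is the weight. The term \<open>v x\<^sup>\<dagger> + y v\<^sup>\<dagger>\<close> counts twice because it has rank two in general.
  The coefficient \<open>C\<close> is a \<open>1 \<times> 1\<close> matrix, so \<open>u C u\<^sup>\<dagger>\<close> is any complex multiple of \<open>u u\<^sup>\<dagger>\<close>.\<close>

inductive star_sum :: "nat \<Rightarrow> nat \<Rightarrow> complex mat \<Rightarrow> bool" where
  zero: "star_sum n 0 (0\<^sub>m n n)"
| diag: "star_sum n k A \<Longrightarrow> u \<in> carrier_mat n 1 \<Longrightarrow> C \<in> carrier_mat 1 1 \<Longrightarrow>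
    star_sum n (Suc k) (A + u * C * u\<^sup>\<dagger>)"
| cross: "star_sum n k A \<Longrightarrow> v \<in> carrier_mat n 1 \<Longrightarrow> x \<in> carrier_mat n 1 \<Longrightarrow>
    y \<in> carrier_mat n 1 \<Longrightarrow> star_sum n (Suc (Suc k)) (A + (v * x\<^sup>\<dagger> + y * v\<^sup>\<dagger>))"

lemma star_sum_carrier: "star_sum n k A \<Longrightarrow> A \<in> carrier_mat n n"
  by (induction rule: star_sum.induct) auto

text \<open>Congruence acts on the vectors of each term. Rectangular \<open>T\<close> are allowed: this is how a sum
  found in smaller dimension is transported back.\<close>

lemma star_sum_congruence:
  assumes "star_sum n k A" and "T \<in> carrier_mat m n"
  shows "star_sum m k (T * A * T\<^sup>\<dagger>)"
  using assms
proof (induction rule: star_sum.induct)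
  case (zero n)
  then show ?case using star_sum.zero[of m] by simp
next
  case (diag n k A u C)
  note A = star_sum_carrier[OF diag.hyps(1)]
  have "T * (A + u * C * u\<^sup>\<dagger>) * T\<^sup>\<dagger> = T * A * T\<^sup>\<dagger> + (T * u) * C * (T * u)\<^sup>\<dagger>"
    using diag A by (simp add: mat_dims)
  then show ?case using diag star_sum.diag[of m k "T * A * T\<^sup>\<dagger>" "T * u" C] by simp
next
  case (cross n k A v x y)
  note A = star_sum_carrier[OF cross.hyps(1)]
  have "T * (A + (v * x\<^sup>\<dagger> + y * v\<^sup>\<dagger>)) * T\<^sup>\<dagger>
      = T * A * T\<^sup>\<dagger> + ((T * v) * (T * x)\<^sup>\<dagger> + (T * y) * (T * v)\<^sup>\<dagger>)"
    using cross A by (simp add: mat_dims)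
  then show ?case using cross star_sum.cross[of m k "T * A * T\<^sup>\<dagger>" "T * v" "T * x" "T * y"] by simp
qed

lemma star_sum_pad:
  assumes "star_sum n k A" and "k \<le> r"
  shows "star_sum n r A"
  using assms(2)
proof (induction r rule: dec_induct)
  case base
  then show ?case by (fact assms(1))
next
  case (step r)
  have "A + 0\<^sub>m n 1 * 0\<^sub>m 1 1 * (0\<^sub>m n 1)\<^sup>\<dagger> = A"
    using star_sum_carrier[OF assms(1)] by simp
  then show ?case
    using star_sum.diag[OF step.IH, of "0\<^sub>m n 1" "0\<^sub>m 1 1"] by simp
qed

lemma star_sum_entries:
  assumes "star_sum n k A"
  obtains l s :: nat and c :: "nat \<Rightarrow> complex" and u v x y :: "nat \<Rightarrow> nat \<Rightarrow> complex"
  where "l + 2 * s = k"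
    and "\<And>i j. i < n \<Longrightarrow> j < n \<Longrightarrow> A $$ (i, j) = (\<Sum>p=1..l. c p * u p i * cnj (u p j))
      + (\<Sum>q=1..s. v q i * cnj (x q j)) + (\<Sum>q=1..s. y q i * cnj (v q j))"
proof -
  have "\<exists>l s c u v x y. l + 2 * s = k \<and> (\<forall>i<n. \<forall>j<n. A $$ (i, j) = (\<Sum>p=1..l. c p * u p i * cnj (u p j))
      + (\<Sum>q=1..s. v q i * cnj (x q j)) + (\<Sum>q=1..s. y q i * cnj (v q j)))"
    using assms
  proof (induction rule: star_sum.induct)
    case (zero n)
    show ?case by (intro exI[of _ "0::nat"]) auto
  next
    case (diag n k A u0 C)
    then obtain l s c u v x y where ls: "l + 2 * s = k"
      and e: "\<And>i j. i < n \<Longrightarrow> j < n \<Longrightarrow> A $$ (i, j) = (\<Sum>p=1..l. c p * u p i * cnj (u p j))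
      + (\<Sum>q=1..s. v q i * cnj (x q j)) + (\<Sum>q=1..s. y q i * cnj (v q j))" by blast
    let ?c = "c(Suc l := C $$ (0,0))" let ?u = "u(Suc l := \<lambda>i. u0 $$ (i,0))"
    have old: "(\<Sum>p=1..l. ?c p * ?u p i * cnj (?u p j)) = (\<Sum>p=1..l. c p * u p i * cnj (u p j))" for i j
      by (intro sum.cong) auto
    have new: "(u0 * C * u0\<^sup>\<dagger>) $$ (i, j) = C $$ (0,0) * u0 $$ (i,0) * cnj (u0 $$ (j,0))" if "i < n" "j < n" for i j
      using diag.hyps that by (auto simp: scalar_prod_def One_nat_def)
    have entries: "(A + u0 * C * u0\<^sup>\<dagger>) $$ (i, j) = (\<Sum>p=1..Suc l. ?c p * ?u p i * cnj (?u p j))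
      + (\<Sum>q=1..s. v q i * cnj (x q j)) + (\<Sum>q=1..s. y q i * cnj (v q j))" if "i < n" "j < n" for i j
    proof -
      have "(A + u0 * C * u0\<^sup>\<dagger>) $$ (i, j) = A $$ (i, j) + (u0 * C * u0\<^sup>\<dagger>) $$ (i, j)"
        using diag.hyps that by (intro index_add_mat) auto
      then show ?thesis using that by (simp add: old new e del: fun_upd_apply index_mult_mat) simp
    qed
    show ?case
      by (rule exI[of _ "Suc l"], rule exI[of _ s], rule exI[of _ ?c], rule exI[of _ ?u], rule exI[of _ v],
          rule exI[of _ x], rule exI[of _ y], intro conjI allI impI entries) (use ls in simp_all)
  next
    case (cross n k A v0 x0 y0)
    then obtain l s c u v x y where ls: "l + 2 * s = k"
      and e: "\<And>i j. i < n \<Longrightarrow> j < n \<Longrightarrow> A $$ (i, j) = (\<Sum>p=1..l. c p * u p i * cnj (u p j))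
      + (\<Sum>q=1..s. v q i * cnj (x q j)) + (\<Sum>q=1..s. y q i * cnj (v q j))" by blast
    let ?v = "v(Suc s := \<lambda>i. v0 $$ (i,0))" let ?x = "x(Suc s := \<lambda>i. x0 $$ (i,0))"
    let ?y = "y(Suc s := \<lambda>i. y0 $$ (i,0))"
    have old: "(\<Sum>q=1..s. ?v q i * cnj (?x q j)) = (\<Sum>q=1..s. v q i * cnj (x q j))"
      "(\<Sum>q=1..s. ?y q i * cnj (?v q j)) = (\<Sum>q=1..s. y q i * cnj (v q j))" for i j
      by (rule sum.cong; simp)+
    have new: "(v0 * x0\<^sup>\<dagger> + y0 * v0\<^sup>\<dagger>) $$ (i, j) = v0 $$ (i,0) * cnj (x0 $$ (j,0)) + y0 $$ (i,0) * cnj (v0 $$ (j,0))"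
      if "i < n" "j < n" for i j
      using cross.hyps that by (auto simp: scalar_prod_def One_nat_def)
    have entries: "(A + (v0 * x0\<^sup>\<dagger> + y0 * v0\<^sup>\<dagger>)) $$ (i, j) = (\<Sum>p=1..l. c p * u p i * cnj (u p j))
      + (\<Sum>q=1..Suc s. ?v q i * cnj (?x q j)) + (\<Sum>q=1..Suc s. ?y q i * cnj (?v q j))" if "i < n" "j < n" for i j
    proof -
      have "(A + (v0 * x0\<^sup>\<dagger> + y0 * v0\<^sup>\<dagger>)) $$ (i, j) = A $$ (i, j) + (v0 * x0\<^sup>\<dagger> + y0 * v0\<^sup>\<dagger>) $$ (i, j)"
        using cross.hyps that by (intro index_add_mat) auto
      then show ?thesis using that by (simp add: old new e del: fun_upd_apply index_mult_mat index_add_mat) simp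
    qed
    show ?case
      by (rule exI[of _ l], rule exI[of _ "Suc s"], rule exI[of _ c], rule exI[of _ u], rule exI[of _ ?v],
          rule exI[of _ ?x], rule exI[of _ ?y], intro conjI allI impI entries) (use ls in simp_all)
  qed
  then show thesis using that by blast
qed

section \<open>Minors of a pencil and its normal rank\<close>

lemma pencil_dim [simp]:
  "dim_row (pencil A B) = dim_row A" "dim_col (pencil A B) = dim_col A"
  by (simp_all add: pencil_def)

lemma pencil_index [simp]:
  "i < dim_row A \<Longrightarrow> j < dim_col A \<Longrightarrow> pencil A B $$ (i, j) = [:A $$ (i, j), B $$ (i, j):]"
  by (simp add: pencil_def)

lemma pencil_carrier [simp, intro]: "A \<in> carrier_mat n m \<Longrightarrow> pencil A B \<in> carrier_mat n m"
  by auto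

lemma pencil_zero [simp]: "pencil (0\<^sub>m n m) (0\<^sub>m n m) = 0\<^sub>m n m"
  by (rule eq_matI) auto

lemma pencil_four_block:
  assumes "A1 \<in> carrier_mat a c" "A2 \<in> carrier_mat a d" "A3 \<in> carrier_mat b c" "A4 \<in> carrier_mat b d"
    and "B1 \<in> carrier_mat a c" "B2 \<in> carrier_mat a d" "B3 \<in> carrier_mat b c" "B4 \<in> carrier_mat b d"
  shows "pencil (four_block_mat A1 A2 A3 A4) (four_block_mat B1 B2 B3 B4)
    = four_block_mat (pencil A1 B1) (pencil A2 B2) (pencil A3 B3) (pencil A4 B4)"
  by (rule eq_matI) (use assms in auto)

definition stack_rows :: "complex mat \<Rightarrow> complex mat \<Rightarrow> complex mat" where
  "stack_rows p P = mat (Suc (dim_row P)) (dim_col P)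
     (\<lambda>(i, j). if i = 0 then p $$ (0, j) else P $$ (i - 1, j))"

definition stack_cols :: "complex mat \<Rightarrow> complex mat \<Rightarrow> complex mat" where
  "stack_cols q Q = mat (dim_row Q) (Suc (dim_col Q))
     (\<lambda>(i, j). if j = 0 then q $$ (i, 0) else Q $$ (i, j - 1))"

lemma stack_carrier [simp]:
  "P \<in> carrier_mat k n \<Longrightarrow> stack_rows p P \<in> carrier_mat (Suc k) n"
  "Q \<in> carrier_mat n k \<Longrightarrow> stack_cols q Q \<in> carrier_mat n (Suc k)"
  by (auto simp: stack_rows_def stack_cols_def)

lemma stack_rows_mult:
  assumes "p \<in> carrier_mat 1 n" "P \<in> carrier_mat k n" "Y \<in> carrier_mat n m"
  shows "stack_rows p P * Y = stack_rows (p * Y) (P * Y)"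
  by (rule eq_matI) (use assms in \<open>auto simp: stack_rows_def scalar_prod_def\<close>)

lemma mult_stack_cols:
  assumes "q \<in> carrier_mat n 1" "Q \<in> carrier_mat n k" "Y \<in> carrier_mat m n"
  shows "Y * stack_cols q Q = stack_cols (Y * q) (Y * Q)"
  by (rule eq_matI) (use assms in \<open>auto simp: stack_cols_def scalar_prod_def\<close>)

lemma stack_eq_four_block:
  assumes "a \<in> carrier_mat 1 1" "b \<in> carrier_mat 1 l" "c \<in> carrier_mat k 1" "d \<in> carrier_mat k l"
  shows "stack_rows (stack_cols a b) (stack_cols c d) = four_block_mat a b c d"
  by (rule eq_matI) (use assms in \<open>auto simp: stack_rows_def stack_cols_def\<close>)

lemma stack_zero [simp]:
  "stack_rows (0\<^sub>m 1 l) (0\<^sub>m k l) = 0\<^sub>m (Suc k) l"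
  by (rule eq_matI) (auto simp: stack_rows_def)

text \<open>Bordering by a row \<open>p\<close> and a column \<open>q\<close> makes a block triangular matrix as soon as one of the two
  off-diagonal blocks vanishes for both coefficients.\<close>

lemma det_pencil_border:
  assumes A: "A \<in> carrier_mat n n" and B: "B \<in> carrier_mat n n"
    and P: "P \<in> carrier_mat k n" and Q: "Q \<in> carrier_mat n k"
    and p: "p \<in> carrier_mat 1 n" and q: "q \<in> carrier_mat n 1"
    and zero: "p * A * Q = 0\<^sub>m 1 k \<and> p * B * Q = 0\<^sub>m 1 k \<or> P * A * q = 0\<^sub>m k 1 \<and> P * B * q = 0\<^sub>m k 1"
  shows "det (pencil (stack_rows p P * A * stack_cols q Q) (stack_rows p P * B * stack_cols q Q))
    = [:(p * A * q) $$ (0,0), (p * B * q) $$ (0,0):] * det (pencil (P * A * Q) (P * B * Q))"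
proof -
  have block: "stack_rows p P * M * stack_cols q Q
      = four_block_mat (p * M * q) (p * M * Q) (P * M * q) (P * M * Q)"
    if M: "M \<in> carrier_mat n n" for M
  proof -
    have "stack_rows p P * M * stack_cols q Q = stack_rows (p * (M * stack_cols q Q)) (P * (M * stack_cols q Q))"
      using M P Q p q by (subst stack_rows_mult[symmetric, of _ n _ k _ "Suc k"]) (auto simp: assoc_mult_mat[of _ "Suc k" n _ n _ "Suc k"])
    also have "p * (M * stack_cols q Q) = stack_cols (p * M * q) (p * M * Q)"
      using M Q p q by (simp add: mult_stack_cols[of _ n _ k _ 1] assoc_mult_mat[of p 1 n M n "stack_cols q Q" "Suc k", symmetric])
    also have "P * (M * stack_cols q Q) = stack_cols (P * M * q) (P * M * Q)"
      using M Q P q by (simp add: mult_stack_cols[of _ n _ k _ k] assoc_mult_mat[of P k n M n "stack_cols q Q" "Suc k", symmetric])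
    also have "stack_rows (stack_cols (p * M * q) (p * M * Q)) (stack_cols (P * M * q) (P * M * Q))
      = four_block_mat (p * M * q) (p * M * Q) (P * M * q) (P * M * Q)"
      using M P Q p q by (intro stack_eq_four_block) auto
    finally show ?thesis .
  qed
  have corner: "det (pencil (p * A * q) (p * B * q)) = [:(p * A * q) $$ (0,0), (p * B * q) $$ (0,0):]"
    using p q by (subst det_single) auto
  have "pencil (stack_rows p P * A * stack_cols q Q) (stack_rows p P * B * stack_cols q Q)
    = four_block_mat (pencil (p * A * q) (p * B * q)) (pencil (p * A * Q) (p * B * Q))
        (pencil (P * A * q) (P * B * q)) (pencil (P * A * Q) (P * B * Q))"
    unfolding block[OF A] block[OF B] using A B P Q p q
    by (intro pencil_four_block) auto
  moreover have "pencil (p * A * q) (p * B * q) \<in> carrier_mat 1 1"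
    "pencil (p * A * Q) (p * B * Q) \<in> carrier_mat 1 k"
    "pencil (P * A * q) (P * B * q) \<in> carrier_mat k 1"
    "pencil (P * A * Q) (P * B * Q) \<in> carrier_mat k k"
    using A P Q p q by auto
  moreover have "pencil (p * A * Q) (p * B * Q) = 0\<^sub>m 1 k \<or> pencil (P * A * q) (P * B * q) = 0\<^sub>m k 1"
    using zero by (elim disjE conjE) (simp_all only: pencil_zero simp_thms)
  ultimately show ?thesis
    unfolding corner[symmetric]
    by (metis det_four_block_mat_upper_right_zero det_four_block_mat_lower_left_zero)
qed

text \<open>The columns of \<open>M Q\<close> are linearly independent, and adjoining them to the columns of \<open>M\<close> does not
  enlarge the column space.\<close>

lemma rank_ge_minor:
  fixes M :: "'a :: field mat"
  assumes M: "M \<in> carrier_mat n n" and P: "P \<in> carrier_mat k n" and Q: "Q \<in> carrier_mat n k"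
    and det: "det (P * M * Q) \<noteq> 0"
  shows "k \<le> vec_space.rank n M"
proof -
  interpret vec_space "TYPE('a)" n .
  let ?N = "M * Q"
  have N: "?N \<in> carrier_mat n k" using M Q by auto
  have PN: "P * M * Q = P * ?N" using P M Q by auto
  have inj: "v = 0\<^sub>v k" if v: "v \<in> carrier_vec k" "?N *\<^sub>v v = 0\<^sub>v n" for v
  proof (rule ccontr)
    assume "v \<noteq> 0\<^sub>v k"
    moreover have "P * ?N *\<^sub>v v = 0\<^sub>v k"
      using P N v by (subst assoc_mult_mat_vec[of _ k n _ k]) auto
    ultimately show False
      using det v(1) det_0_iff_vec_prod_zero_field[of "P * ?N" k] P N unfolding PN by auto
  qed
  have dist: "distinct (cols ?N)"
  proof (rule ccontr)
    assume "\<not> distinct (cols ?N)"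
    then obtain i j where ij: "i < k" "j < k" "i \<noteq> j" "col ?N i = col ?N j"
      using N by (auto simp: distinct_conv_nth)
    have "?N $$ (r, i) = ?N $$ (r, j)" if "r < n" for r
      using ij that N by (metis carrier_matD index_col)
    then have "?N *\<^sub>v (unit_vec k i - unit_vec k j) = 0\<^sub>v n"
      using N ij by (intro eq_vecI) (auto simp del: index_mult_mat simp: scalar_prod_minus_distrib[of _ k])
    then have "unit_vec k i - unit_vec k j = (0\<^sub>v k :: 'a vec)"
      by (intro inj) auto
    then have "(unit_vec k i - unit_vec k j) $ i = (0 :: 'a)"
      using ij by simp
    then show False using ij by simp
  qed
  have indpt: "lin_indpt (set (cols ?N))"
    using lin_depE[OF N _ dist] inj by metis
  have colsM: "set (cols M) \<subseteq> carrier_vec n" using cols_dim[of M] M by auto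
  have sub: "set (cols ?N) \<subseteq> span (set (cols M))"
  proof
    fix w assume "w \<in> set (cols ?N)"
    then obtain j where j: "j < k" "w = col ?N j"
      using N by (auto simp: in_set_conv_nth)
    then have "w = M *\<^sub>v col Q j" using M Q by auto
    then show "w \<in> span (set (cols M))"
    proof -
      have "w = mat_of_cols n (cols M) *\<^sub>v col Q j"
        using \<open>w = M *\<^sub>v col Q j\<close> M mat_of_cols_cols[of M] by simp
      also have "\<dots> = lincomb (\<lambda>l. sum (\<lambda>i. if l = cols M ! i then col Q j $ i else 0) {0..<length (cols M)})
          (set (cols M))"
        using M Q j colsM by (intro mat_of_cols_mult_as_finsum) auto
      finally show ?thesis by (auto simp: span_def)
    qed
  qed
  let ?L = "cols M @ cols ?N"
  have L: "set ?L \<subseteq> carrier_vec n"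
    using colsM cols_dim[of ?N] unfolding carrier_matD(1)[OF N] by simp
  let ?K = "mat_of_cols n ?L"
  have "cols ?K = ?L" using L by (simp add: cols_mat_of_cols)
  have spans: "span (set ?L) = span (set (cols M))"
  proof
    show "span (set (cols M)) \<subseteq> span (set ?L)" by (rule span_is_monotone) auto
    show "span (set ?L) \<subseteq> span (set (cols M))"
      using sub in_own_span[OF colsM] span_is_submodule[OF colsM] by (intro span_is_subset) auto
  qed
  have "k = card (set (cols ?N))" using distinct_card[OF dist] unfolding cols_length carrier_matD(2)[OF N] by simp
  also have "\<dots> \<le> rank ?K"
    using indpt \<open>cols ?K = ?L\<close> by (intro rank_ge_card_indpt[of _ "length ?L"]) auto
  also have "\<dots> = rank M" unfolding rank_def \<open>cols ?K = ?L\<close> spans ..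
  finally show ?thesis .
qed

lemma pencil_congruence:
  assumes A: "A \<in> carrier_mat n n" and B: "B \<in> carrier_mat n n"
    and P: "P \<in> carrier_mat k n" and Q: "Q \<in> carrier_mat n l"
  shows "pencil (P * A * Q) (P * B * Q)
    = map_mat (\<lambda>c. [:c:]) P * pencil A B * map_mat (\<lambda>c. [:c:]) Q"
proof -
  interpret c: semiring_hom "\<lambda>c::complex. [:c:]"
    by unfold_locales auto
  let ?h = "map_mat (\<lambda>c::complex. [:c:])"
  have pencil: "pencil M N = ?h M + [:0, 1:] \<cdot>\<^sub>m ?h N" if "M \<in> carrier_mat a b" "N \<in> carrier_mat a b" for M N a b
    by (rule eq_matI) (use that in auto)
  have "?h P * pencil A B * ?h Q = (?h P * ?h A + [:0, 1:] \<cdot>\<^sub>m (?h P * ?h B)) * ?h Q"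
    using A B P by (simp add: pencil[OF A B] mult_add_distrib_mat[of _ k n _ n] mult_smult_distrib[of _ k n _ n])
  also have "\<dots> = ?h P * ?h A * ?h Q + [:0, 1:] \<cdot>\<^sub>m (?h P * ?h B * ?h Q)"
    using A B P Q by (subst add_mult_distrib_mat[of _ k n _ _ l]) (auto simp: mult_smult_assoc_mat[of _ k n _ l])
  also have "\<dots> = pencil (P * A * Q) (P * B * Q)"
    using A B P Q
    by (simp add: pencil[of _ k l] c.mat_hom_mult[of _ k n _ n] c.mat_hom_mult[of _ k n _ l]
        c.mat_hom_mult[of _ n n _ l])
  finally show ?thesis by simp
qed

text \<open>Constant \<open>P\<close> and \<open>Q\<close> instead of a choice of rows and columns make the notion invariant under
  changes of basis.\<close>

definition has_minor :: "nat \<Rightarrow> nat \<Rightarrow> complex mat \<Rightarrow> bool" where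
  "has_minor n k A \<longleftrightarrow> (\<exists>P\<in>carrier_mat k n. \<exists>Q\<in>carrier_mat n k.
     det (pencil (P * A * Q) (P * A\<^sup>\<dagger> * Q)) \<noteq> 0)"

lemma minor_le_normal_rank:
  assumes A: "A \<in> carrier_mat n n" and "has_minor n k A"
  shows "k \<le> normal_rank (pencil A (A\<^sup>\<dagger>))"
proof -
  obtain P Q where P: "P \<in> carrier_mat k n" and Q: "Q \<in> carrier_mat n k"
    and d: "det (pencil (P * A * Q) (P * A\<^sup>\<dagger> * Q)) \<noteq> 0"
    using assms(2) by (auto simp: has_minor_def)
  interpret f: inj_idom_hom "to_fract :: complex poly \<Rightarrow> complex poly fract"
    by unfold_locales (auto simp: to_fract_eq_0_iff)
  let ?h = "map_mat (\<lambda>c::complex. [:c:])" let ?f = "map_mat (to_fract :: complex poly \<Rightarrow> _)"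
  have h: "?h P \<in> carrier_mat k n" "?h Q \<in> carrier_mat n k" "pencil A (A\<^sup>\<dagger>) \<in> carrier_mat n n"
    using A P Q by auto
  have "?f (?h P) * ?f (pencil A (A\<^sup>\<dagger>)) * ?f (?h Q) = ?f (pencil (P * A * Q) (P * A\<^sup>\<dagger> * Q))"
    using h pencil_congruence[OF A adjoint_carrier[OF A] P Q]
    by (simp only: f.mat_hom_mult[of _ k n _ n] f.mat_hom_mult[of _ k n _ k] mult_carrier_mat)
  then have "det (?f (?h P) * ?f (pencil A (A\<^sup>\<dagger>)) * ?f (?h Q)) \<noteq> 0"
    using d by simp
  then have "k \<le> vec_space.rank n (?f (pencil A (A\<^sup>\<dagger>)))"
    using h by (intro rank_ge_minor[of _ n "?f (?h P)" k "?f (?h Q)"]) auto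
  then show ?thesis using A by (simp add: normal_rank_def)
qed

section \<open>Vectors on which the pencil degenerates, and complements\<close>

lemma adjoint_mult_self_nonzero:
  fixes z :: "complex mat"
  assumes "z \<in> carrier_mat n 1" and "z \<noteq> 0\<^sub>m n 1"
  shows "(z\<^sup>\<dagger> * z) $$ (0,0) \<noteq> 0"
proof -
  obtain i where i: "i < n" "z $$ (i, 0) \<noteq> 0"
    using assms by (metis One_nat_def carrier_matD eq_matI index_zero_mat less_Suc0)
  have "(z\<^sup>\<dagger> * z) $$ (0,0) = (\<Sum>k<n. cnj (z $$ (k,0)) * z $$ (k,0))"
    using assms by (auto simp: scalar_prod_def atLeast0LessThan intro!: sum.cong)
  also have "\<dots> = of_real (\<Sum>k<n. (cmod (z $$ (k,0)))\<^sup>2)"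
    by (simp add: complex_norm_square mult.commute del: of_real_power)
  also have "\<dots> \<noteq> 0"
    using i by (subst of_real_eq_0_iff, subst sum_nonneg_eq_0_iff) auto
  finally show ?thesis .
qed

text \<open>If \<open>z\<^sup>\<dagger> x \<noteq> 0\<close>, the space is the direct sum of the line of \<open>x\<close> and the orthogonal complement of \<open>z\<close>.
  The columns of \<open>W\<close> are a basis of that complement, and \<open>W R\<close> is the projection \<open>P\<close> onto it along \<open>x\<close>.
  Since \<open>z\<^sup>\<dagger> P = 0\<close>, a row \<open>i\<close> of \<open>P\<close> with \<open>z\<^sub>i \<noteq> 0\<close> is a combination of the others: \<open>R\<close> omits this
  row and \<open>W\<close> restores it.\<close>

lemma complement_factorization:
  fixes x z :: "complex mat"
  assumes x: "x \<in> carrier_mat (Suc m) 1" and z: "z \<in> carrier_mat (Suc m) 1"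
    and zx: "(z\<^sup>\<dagger> * x) $$ (0,0) \<noteq> 0"
  obtains W R g where "W \<in> carrier_mat (Suc m) m" "R \<in> carrier_mat m (Suc m)"
    "g \<in> carrier_mat 1 1" "x * g * z\<^sup>\<dagger> + W * R = 1\<^sub>m (Suc m)" "z\<^sup>\<dagger> * W = 0\<^sub>m 1 m"
proof -
  let ?n = "Suc m"
  define c where "c = (z\<^sup>\<dagger> * x) $$ (0,0)"
  define P where "P = (\<lambda>i j. (if i = j then 1 else 0) - x $$ (i,0) * cnj (z $$ (j,0)) / c)"
  have c: "c = (\<Sum>k<?n. cnj (z $$ (k,0)) * x $$ (k,0))"
    using x z by (auto simp: c_def scalar_prod_def atLeast0LessThan intro!: sum.cong)
  have c0: "c \<noteq> 0" using zx by (simp add: c_def)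
  have zP: "(\<Sum>k<?n. cnj (z $$ (k,0)) * P k j) = 0" if "j < ?n" for j
  proof -
    have "(\<Sum>k<?n. cnj (z $$ (k,0)) * P k j)
      = (\<Sum>k<?n. (if k = j then cnj (z $$ (k,0)) else 0) - cnj (z $$ (k,0)) * x $$ (k,0) * (cnj (z $$ (j,0)) / c))"
      by (intro sum.cong) (auto simp: P_def algebra_simps)
    also have "\<dots> = cnj (z $$ (j,0)) - c * (cnj (z $$ (j,0)) / c)"
      unfolding sum_subtractf sum_distrib_right[symmetric] c[symmetric] using that by simp
    finally show ?thesis using c0 by simp
  qed
  obtain i where i: "i < ?n" "z $$ (i,0) \<noteq> 0"
  proof (rule ccontr)
    assume "\<not> thesis"
    then have "c = 0" using that unfolding c by (intro sum.neutral) auto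
    then show False using c0 by simp
  qed
  have bij: "bij_betw (insert_index i) {..<m} ({..<?n} - {i})"
    by (rule bij_betwI[of _ _ _ "delete_index i"])
      (use i in \<open>auto simp: insert_index_def delete_index_def split: if_splits\<close>)
  have split_sum: "(\<Sum>k<?n. f k) = f i + (\<Sum>k<m. f (insert_index i k))" for f :: "nat \<Rightarrow> complex"
    using sum.reindex_bij_betw[OF bij, of f] i by (subst sum.remove[of _ i]) auto
  define W where "W = mat ?n m (\<lambda>(a,k). if a = i then - cnj (z $$ (insert_index i k,0)) / cnj (z $$ (i,0))
      else if a = insert_index i k then 1 else 0)"
  define R where "R = mat m ?n (\<lambda>(k,j). P (insert_index i k) j)"
  define g where "g = mat 1 1 (\<lambda>_. 1 / c)"
  have ne: "insert_index i k \<noteq> i" for k by (auto simp: insert_index_def)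
  have ins: "k < m \<Longrightarrow> insert_index i k < ?n" for k by (auto simp: insert_index_def)
  show thesis
  proof
    show "W \<in> carrier_mat ?n m" "R \<in> carrier_mat m ?n" "g \<in> carrier_mat 1 1"
      by (simp_all add: W_def R_def g_def)
    show "z\<^sup>\<dagger> * W = 0\<^sub>m 1 m"
    proof (rule eq_matI)
      fix a k assume "a < dim_row (0\<^sub>m 1 m)" "k < dim_col (0\<^sub>m 1 m)"
      then have a: "a = 0" and k: "k < m" by auto
      have "(z\<^sup>\<dagger> * W) $$ (0,k) = (\<Sum>b<?n. cnj (z $$ (b,0)) * W $$ (b,k))"
        using k z by (auto simp: scalar_prod_def atLeast0LessThan W_def intro!: sum.cong)
      also have "\<dots> = - cnj (z $$ (insert_index i k,0)) + (\<Sum>b<m. if b = k then cnj (z $$ (insert_index i k,0)) else 0)"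
        unfolding split_sum using i k ins ne
        by (intro arg_cong2[where f = "(+)"] sum.cong) (auto simp: W_def, (metis delete_insert_index)+)
      finally show "(z\<^sup>\<dagger> * W) $$ (a,k) = 0\<^sub>m 1 m $$ (a,k)" using k a by simp
    qed (use z in \<open>auto simp: W_def\<close>)
    have WR: "(W * R) $$ (a,j) = P a j" if a: "a < ?n" and j: "j < ?n" for a j
    proof -
      have e: "(W * R) $$ (a,j) = (\<Sum>k<m. W $$ (a,k) * P (insert_index i k) j)"
        using a j by (auto simp: scalar_prod_def atLeast0LessThan W_def R_def intro!: sum.cong)
      show ?thesis
      proof (cases "a = i")
        case True
        have "cnj (z $$ (i,0)) * (W * R) $$ (a,j) = - (\<Sum>k<m. cnj (z $$ (insert_index i k,0)) * P (insert_index i k) j)"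
          unfolding e sum_distrib_left sum_negf[symmetric] using True i a by (intro sum.cong) (auto simp: W_def)
        also have "\<dots> = cnj (z $$ (i,0)) * P i j" using zP[OF j] unfolding split_sum
          by (simp add: add_eq_0_iff)
        finally show ?thesis using True i by simp
      next
        case False
        then obtain b where b: "b < m" "a = insert_index i b"
          using bij a unfolding bij_betw_def by auto
        have "(\<Sum>k<m. W $$ (a,k) * P (insert_index i k) j) = (\<Sum>k<m. if k = b then P a j else 0)"
          using b a False by (intro sum.cong) (auto simp: W_def, (metis delete_insert_index)+)
        then show ?thesis using e b by simp
      qed
    qed
    have xg: "(x * g * z\<^sup>\<dagger>) $$ (a,j) = x $$ (a,0) * cnj (z $$ (j,0)) / c"
      if "a < ?n" and "j < ?n" for a j
      using that x z by (auto simp: scalar_prod_def g_def One_nat_def)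
    show "x * g * z\<^sup>\<dagger> + W * R = 1\<^sub>m ?n"
    proof (rule eq_matI)
      fix a j assume "a < dim_row (1\<^sub>m ?n :: complex mat)" "j < dim_col (1\<^sub>m ?n :: complex mat)"
      then have aj: "a < ?n" "j < ?n" by auto
      have "(x * g * z\<^sup>\<dagger> + W * R) $$ (a, j) = (x * g * z\<^sup>\<dagger>) $$ (a, j) + (W * R) $$ (a, j)"
        using aj by (intro index_add_mat) (auto simp: W_def R_def)
      then show "(x * g * z\<^sup>\<dagger> + W * R) $$ (a, j) = 1\<^sub>m ?n $$ (a, j)"
        using aj by (simp only: WR xg) (simp add: P_def)
    qed (auto simp: W_def R_def)
  qed
qed

lemma column_matrix:
  fixes v :: "complex vec"
  assumes "v \<in> carrier_vec n" and "v \<noteq> 0\<^sub>v n"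
  shows "mat_of_cols n [v] \<in> carrier_mat n 1" "mat_of_cols n [v] \<noteq> 0\<^sub>m n 1"
    and "A \<in> carrier_mat m n \<Longrightarrow> A * mat_of_cols n [v] = mat_of_cols m [A *\<^sub>v v]"
proof -
  show "mat_of_cols n [v] \<in> carrier_mat n 1" by (auto simp: One_nat_def)
  obtain i where "i < n" "v $ i \<noteq> 0" using assms by (metis carrier_vecD eq_vecI index_zero_vec)
  then have "mat_of_cols n [v] $$ (i, 0) \<noteq> 0\<^sub>m n 1 $$ (i, 0)" by (simp add: mat_of_cols_index)
  then show "mat_of_cols n [v] \<noteq> 0\<^sub>m n 1" by metis
  show "A \<in> carrier_mat m n \<Longrightarrow> A * mat_of_cols n [v] = mat_of_cols m [A *\<^sub>v v]"
    using assms by (intro eq_matI) (auto simp: mat_of_cols_index scalar_prod_def)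
qed

text \<open>If \<open>B\<close> is singular, a kernel vector of \<open>B\<close> will do. Otherwise an eigenvector of \<open>B\<^sup>-\<^sup>1 A\<close> does, with
  \<open>z = B x\<close>.\<close>

lemma pencil_eigenvector:
  fixes A B :: "complex mat"
  assumes A: "A \<in> carrier_mat n n" and B: "B \<in> carrier_mat n n" and "n > 0"
  obtains x z a b where "x \<in> carrier_mat n 1" "x \<noteq> 0\<^sub>m n 1" "z \<in> carrier_mat n 1"
    "a \<in> carrier_mat 1 1" "b \<in> carrier_mat 1 1" "A * x = z * a" "B * x = z * b"
proof (cases "det B = 0")
  case True
  then obtain v where v: "v \<in> carrier_vec n" "v \<noteq> 0\<^sub>v n" "B *\<^sub>v v = 0\<^sub>v n"
    using det_0_iff_vec_prod_zero_field[OF B] by auto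
  have "B * mat_of_cols n [v] = 0\<^sub>m n 1"
    using v B by (simp add: column_matrix) (rule eq_matI, auto simp: mat_of_cols_index)
  then show thesis
    using A column_matrix(1,2)[OF v(1,2)]
    by (intro that[of "mat_of_cols n [v]" "A * mat_of_cols n [v]" "1\<^sub>m 1" "0\<^sub>m 1 1"])
      (auto simp del: mult_carrier_mat intro!: mult_carrier_mat)
next
  case False
  then have "B \<in> Units (ring_mat TYPE(complex) n ())"
    by (rule det_non_zero_imp_unit[OF B])
  then obtain C where C: "C \<in> carrier_mat n n" and BC: "B * C = 1\<^sub>m n"
    by (auto simp: Units_def ring_mat_simps)
  obtain e v where "eigenvector (C * A) v e"
    using spectrum_non_empty[of "C * A" n] A C \<open>n > 0\<close> by (auto simp: spectrum_def eigenvalue_def)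
  then have v: "v \<in> carrier_vec n" "v \<noteq> 0\<^sub>v n" and ev: "C * A *\<^sub>v v = e \<cdot>\<^sub>v v"
    using A C by (auto simp: eigenvector_def)
  let ?x = "mat_of_cols n [v]" let ?e = "mat 1 1 (\<lambda>_. e)"
  have "C * A * ?x = ?x * ?e"
    using v A C by (subst column_matrix(3)[of v n _ n])
      (auto simp: ev intro!: eq_matI simp: mat_of_cols_index scalar_prod_def)
  then have "B * (C * A * ?x) = B * (?x * ?e)" by simp
  moreover have "B * (C * A * ?x) = (B * C) * (A * ?x)" using A B C by (simp add: mat_dims)
  ultimately have "A * ?x = B * ?x * ?e" using A B v BC by (simp add: mat_dims)
  then show thesis
    using B column_matrix(1,2)[OF v]
    by (intro that[of ?x "B * ?x" ?e "1\<^sub>m 1"]) (auto intro!: mult_carrier_mat)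
qed

lemma one_by_one_eq_zero_iff:
  assumes "a \<in> carrier_mat 1 1" shows "a = 0\<^sub>m 1 1 \<longleftrightarrow> a $$ (0,0) = 0"
  using assms by (auto intro!: eq_matI)

section \<open>The induction on the dimension\<close>

text \<open>A minor of the compression \<open>W\<^sup>\<dagger> A W\<close> is a minor of \<open>A\<close>, given by \<open>P W\<^sup>\<dagger>\<close> and \<open>W Q\<close>. The factors are kept
  visible because the bordering needs to know what they annihilate.\<close>

lemma minor_of_compression:
  assumes A: "A \<in> carrier_mat n n" and W: "W \<in> carrier_mat n m"
    and "has_minor m k (W\<^sup>\<dagger> * A * W)"
  obtains P Q where "P \<in> carrier_mat k m" "Q \<in> carrier_mat m k"
    "det (pencil (P * W\<^sup>\<dagger> * A * (W * Q)) (P * W\<^sup>\<dagger> * A\<^sup>\<dagger> * (W * Q))) \<noteq> 0"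
proof -
  obtain P Q where P: "P \<in> carrier_mat k m" and Q: "Q \<in> carrier_mat m k"
    and d: "det (pencil (P * (W\<^sup>\<dagger> * A * W) * Q) (P * (W\<^sup>\<dagger> * A * W)\<^sup>\<dagger> * Q)) \<noteq> 0"
    using assms(3) by (auto simp: has_minor_def)
  have "P * (W\<^sup>\<dagger> * A * W) * Q = P * W\<^sup>\<dagger> * A * (W * Q)"
    "P * (W\<^sup>\<dagger> * A * W)\<^sup>\<dagger> * Q = P * W\<^sup>\<dagger> * A\<^sup>\<dagger> * (W * Q)"
    using A W P Q by (simp_all add: mat_dims)
  with d that[OF P Q] show thesis by simp
qed

lemma has_minor_compression:
  assumes A: "A \<in> carrier_mat n n" and W: "W \<in> carrier_mat n m"
    and "has_minor m k (W\<^sup>\<dagger> * A * W)"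
  shows "has_minor n k A"
  using minor_of_compression[OF assms] W unfolding has_minor_def by (metis adjoint_carrier mult_carrier_mat)

text \<open>Insert \<open>x t + W R = 1\<close> on the right of \<open>A\<close> and its adjoint on the left; the
  hypotheses say that the mixed terms vanish.\<close>

lemma block_diagonal_decomposition:
  fixes A :: "complex mat"
  assumes A: "A \<in> carrier_mat n n" and x: "x \<in> carrier_mat n 1" and t: "t \<in> carrier_mat 1 n"
    and W: "W \<in> carrier_mat n m" and R: "R \<in> carrier_mat m n"
    and one: "x * t + W * R = 1\<^sub>m n"
    and xW: "x\<^sup>\<dagger> * A * W = 0\<^sub>m 1 m" and Wx: "W\<^sup>\<dagger> * A * x = 0\<^sub>m m 1"
  shows "A = R\<^sup>\<dagger> * (W\<^sup>\<dagger> * A * W) * R + t\<^sup>\<dagger> * (x\<^sup>\<dagger> * A * x) * t"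
proof -
  have "A = (x * t + W * R)\<^sup>\<dagger> * A * (x * t + W * R)"
    unfolding one using A by simp
  also have "\<dots> = (t\<^sup>\<dagger> * (x\<^sup>\<dagger> * A * x) * t + R\<^sup>\<dagger> * (W\<^sup>\<dagger> * A * x) * t)
      + (t\<^sup>\<dagger> * (x\<^sup>\<dagger> * A * W) * R + R\<^sup>\<dagger> * (W\<^sup>\<dagger> * A * W) * R)"
    using A x t W R by (simp add: mat_dims)
  also have "\<dots> = t\<^sup>\<dagger> * (x\<^sup>\<dagger> * A * x) * t + R\<^sup>\<dagger> * (W\<^sup>\<dagger> * A * W) * R"
    unfolding xW Wx using A x t W R by (simp add: mat_dims)
  also have "\<dots> = R\<^sup>\<dagger> * (W\<^sup>\<dagger> * A * W) * R + t\<^sup>\<dagger> * (x\<^sup>\<dagger> * A * x) * t"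
    using A x t W R by (intro comm_add_mat) auto
  finally show ?thesis .
qed

text \<open>Split the space into the line of \<open>x\<close> and its orthogonal complement: the block of \<open>x\<close> is zero.\<close>

lemma drop_kernel_vector:
  fixes A :: "complex mat"
  assumes A: "A \<in> carrier_mat (Suc m) (Suc m)"
    and x: "x \<in> carrier_mat (Suc m) 1" "x \<noteq> 0\<^sub>m (Suc m) 1"
    and Ax: "A * x = 0\<^sub>m (Suc m) 1" and Bx: "A\<^sup>\<dagger> * x = 0\<^sub>m (Suc m) 1"
  obtains W R where "W \<in> carrier_mat (Suc m) m" "R \<in> carrier_mat m (Suc m)"
    "A = R\<^sup>\<dagger> * (W\<^sup>\<dagger> * A * W) * R"
proof -
  obtain W R g where W: "W \<in> carrier_mat (Suc m) m" and R: "R \<in> carrier_mat m (Suc m)"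
    and g: "g \<in> carrier_mat 1 1" and one: "x * g * x\<^sup>\<dagger> + W * R = 1\<^sub>m (Suc m)"
    using complement_factorization[OF x(1) x(1) adjoint_mult_self_nonzero[OF x]] by metis
  have "x\<^sup>\<dagger> * A = (A\<^sup>\<dagger> * x)\<^sup>\<dagger>" using A x by (simp add: mat_dims)
  then have xA: "x\<^sup>\<dagger> * A = 0\<^sub>m 1 (Suc m)" by (simp add: Bx)
  have "A = R\<^sup>\<dagger> * (W\<^sup>\<dagger> * A * W) * R + (g * x\<^sup>\<dagger>)\<^sup>\<dagger> * (x\<^sup>\<dagger> * A * x) * (g * x\<^sup>\<dagger>)"
    using A x g W R one Ax by (intro block_diagonal_decomposition) (simp_all add: mat_dims xA)
  also have "\<dots> = R\<^sup>\<dagger> * (W\<^sup>\<dagger> * A * W) * R"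
    using A x g W R by (simp add: xA mat_dims)
  finally show thesis using that W R by metis
qed

lemma star_sum_pullback:
  assumes "star_sum m k (W\<^sup>\<dagger> * A * W)" and "R \<in> carrier_mat m n"
  shows "star_sum n k (R\<^sup>\<dagger> * (W\<^sup>\<dagger> * A * W) * R)"
  using star_sum_congruence[OF assms(1), of "R\<^sup>\<dagger>" n] assms(2) by simp

text \<open>As \<open>A x\<close> and \<open>A\<^sup>\<dagger> x\<close> are multiples of \<open>z\<close>, both \<open>x\<^sup>\<dagger> A\<close> and \<open>x\<^sup>\<dagger> A\<^sup>\<dagger>\<close> are multiples of \<open>z\<^sup>\<dagger>\<close>, so they
  vanish on the orthogonal complement of \<open>z\<close>. Hence \<open>x\<close> splits off as a block of size one, which
  contributes the term \<open>c u u\<^sup>\<dagger>\<close> with \<open>c = x\<^sup>\<dagger> A x \<noteq> 0\<close> and enlarges the minor by the row \<open>x\<^sup>\<dagger>\<close> and the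
  column \<open>x\<close>.\<close>

lemma nonisotropic_step:
  fixes A :: "complex mat"
  assumes A: "A \<in> carrier_mat (Suc m) (Suc m)"
    and x: "x \<in> carrier_mat (Suc m) 1" and z: "z \<in> carrier_mat (Suc m) 1"
    and a: "a \<in> carrier_mat 1 1" and b: "b \<in> carrier_mat 1 1"
    and Ax: "A * x = z * a" and Bx: "A\<^sup>\<dagger> * x = z * b"
    and nz: "\<not> (A * x = 0\<^sub>m (Suc m) 1 \<and> A\<^sup>\<dagger> * x = 0\<^sub>m (Suc m) 1)"
    and zx: "(z\<^sup>\<dagger> * x) $$ (0,0) \<noteq> 0"
    and IH: "\<And>A. A \<in> carrier_mat m m \<Longrightarrow> \<exists>k. star_sum m k A \<and> has_minor m k A"
  shows "\<exists>k. star_sum (Suc m) k A \<and> has_minor (Suc m) k A"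
proof -
  obtain W R g where W: "W \<in> carrier_mat (Suc m) m" and R: "R \<in> carrier_mat m (Suc m)"
    and g: "g \<in> carrier_mat 1 1" and one: "x * g * z\<^sup>\<dagger> + W * R = 1\<^sub>m (Suc m)"
    and zW: "z\<^sup>\<dagger> * W = 0\<^sub>m 1 m"
    using complement_factorization[OF x z zx] by metis
  have Wz: "W\<^sup>\<dagger> * z = 0\<^sub>m m 1"
    using arg_cong[OF zW, of mat_adjoint] z W by (simp add: mat_dims)
  have xA: "x\<^sup>\<dagger> * A = b\<^sup>\<dagger> * z\<^sup>\<dagger>" and xB: "x\<^sup>\<dagger> * A\<^sup>\<dagger> = a\<^sup>\<dagger> * z\<^sup>\<dagger>"
    using arg_cong[OF Bx, of mat_adjoint] arg_cong[OF Ax, of mat_adjoint] A x z a b by (simp_all add: mat_dims)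
  have xAW: "x\<^sup>\<dagger> * A * W = 0\<^sub>m 1 m" and xBW: "x\<^sup>\<dagger> * A\<^sup>\<dagger> * W = 0\<^sub>m 1 m"
    unfolding xA xB using z W a b by (simp_all add: mat_dims zW)
  have "W\<^sup>\<dagger> * A * x = W\<^sup>\<dagger> * z * a" using A W x z a by (simp add: mat_dims Ax)
  then have WAx: "W\<^sup>\<dagger> * A * x = 0\<^sub>m m 1" using a by (simp add: Wz)
  obtain k where k: "star_sum m k (W\<^sup>\<dagger> * A * W)" "has_minor m k (W\<^sup>\<dagger> * A * W)"
    using IH[of "W\<^sup>\<dagger> * A * W"] A W by (metis adjoint_carrier mult_carrier_mat)
  have "A = R\<^sup>\<dagger> * (W\<^sup>\<dagger> * A * W) * R + (g * z\<^sup>\<dagger>)\<^sup>\<dagger> * (x\<^sup>\<dagger> * A * x) * (g * z\<^sup>\<dagger>)"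
  proof (rule block_diagonal_decomposition[OF A x _ W R _ xAW WAx])
    show "x * (g * z\<^sup>\<dagger>) + W * R = 1\<^sub>m (Suc m)"
      using one x g z by (simp add: mat_dims)
  qed (use g z in auto)
  moreover have "star_sum (Suc m) (Suc k) (R\<^sup>\<dagger> * (W\<^sup>\<dagger> * A * W) * R + (g * z\<^sup>\<dagger>)\<^sup>\<dagger> * (x\<^sup>\<dagger> * A * x) * (g * z\<^sup>\<dagger>))"
    using star_sum.diag[OF star_sum_pullback[OF k(1) R], of "(g * z\<^sup>\<dagger>)\<^sup>\<dagger>" "x\<^sup>\<dagger> * A * x"] A x z g
    by (metis adjoint_adjoint adjoint_carrier mult_carrier_mat)
  ultimately have sum: "star_sum (Suc m) (Suc k) A" by simp
  obtain P Q where P: "P \<in> carrier_mat k m" and Q: "Q \<in> carrier_mat m k"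
    and d: "det (pencil (P * W\<^sup>\<dagger> * A * (W * Q)) (P * W\<^sup>\<dagger> * A\<^sup>\<dagger> * (W * Q))) \<noteq> 0"
    using minor_of_compression[OF A W k(2)] by metis
  \<comment> \<open>\<open>x\<^sup>\<dagger> A x\<close> and its conjugate \<open>x\<^sup>\<dagger> A\<^sup>\<dagger> x\<close> are the conjugates of the entries of \<open>b\<close> and \<open>a\<close>, not
    both zero, times \<open>z\<^sup>\<dagger> x\<close>.\<close>
  have c: "(x\<^sup>\<dagger> * A * x) $$ (0,0) \<noteq> 0"
  proof -
    have e: "(x\<^sup>\<dagger> * A * x) $$ (0,0) = cnj (b $$ (0,0)) * (z\<^sup>\<dagger> * x) $$ (0,0)"
      unfolding xA using b x z by (simp add: mat_dims) (simp add: scalar_prod_def One_nat_def)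
    have "(x\<^sup>\<dagger> * A\<^sup>\<dagger> * x) $$ (0,0) = cnj (a $$ (0,0)) * (z\<^sup>\<dagger> * x) $$ (0,0)"
      unfolding xB using a x z by (simp add: mat_dims) (simp add: scalar_prod_def One_nat_def)
    moreover have "x\<^sup>\<dagger> * A\<^sup>\<dagger> * x = (x\<^sup>\<dagger> * A * x)\<^sup>\<dagger>" using A x by (simp add: mat_dims)
    moreover have "((x\<^sup>\<dagger> * A * x)\<^sup>\<dagger>) $$ (0,0) = cnj ((x\<^sup>\<dagger> * A * x) $$ (0,0))" using x by simp
    ultimately have e': "cnj ((x\<^sup>\<dagger> * A * x) $$ (0,0)) = cnj (a $$ (0,0)) * (z\<^sup>\<dagger> * x) $$ (0,0)" by simp
    show ?thesis
    proof
      assume "(x\<^sup>\<dagger> * A * x) $$ (0,0) = 0"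
      with e e' zx have "a $$ (0,0) = 0" "b $$ (0,0) = 0" by auto
      with a b have "a = 0\<^sub>m 1 1" "b = 0\<^sub>m 1 1" by (simp_all add: one_by_one_eq_zero_iff)
      with Ax Bx nz z show False by simp
    qed
  qed
  have "det (pencil (stack_rows (x\<^sup>\<dagger>) (P * W\<^sup>\<dagger>) * A * stack_cols x (W * Q))
        (stack_rows (x\<^sup>\<dagger>) (P * W\<^sup>\<dagger>) * A\<^sup>\<dagger> * stack_cols x (W * Q)))
      = [:(x\<^sup>\<dagger> * A * x) $$ (0,0), (x\<^sup>\<dagger> * A\<^sup>\<dagger> * x) $$ (0,0):] *
        det (pencil (P * W\<^sup>\<dagger> * A * (W * Q)) (P * W\<^sup>\<dagger> * A\<^sup>\<dagger> * (W * Q)))"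
  proof (rule det_pencil_border)
    have "x\<^sup>\<dagger> * A * (W * Q) = x\<^sup>\<dagger> * A * W * Q" "x\<^sup>\<dagger> * A\<^sup>\<dagger> * (W * Q) = x\<^sup>\<dagger> * A\<^sup>\<dagger> * W * Q"
      using A x W Q by (simp_all add: mat_dims)
    then show "x\<^sup>\<dagger> * A * (W * Q) = 0\<^sub>m 1 k \<and> x\<^sup>\<dagger> * A\<^sup>\<dagger> * (W * Q) = 0\<^sub>m 1 k
        \<or> P * W\<^sup>\<dagger> * A * x = 0\<^sub>m k 1 \<and> P * W\<^sup>\<dagger> * A\<^sup>\<dagger> * x = 0\<^sub>m k 1"
      unfolding xAW xBW using Q by simp
  qed (use A x P Q W in auto)
  also have "\<dots> \<noteq> 0" using c d by (simp del: mult_pCons_left)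
  finally have "has_minor (Suc m) (Suc k) A"
    unfolding has_minor_def using P Q W x stack_carrier by (metis adjoint_carrier mult_carrier_mat)
  with sum show ?thesis by blast
qed

text \<open>In a basis consisting of \<open>x\<close>, of a complement of \<open>x\<close> inside the orthogonal complement of \<open>z\<close>, and of \<open>z\<close>,
  the pencil has the block rows \<open>(0, 0, p)\<close>, \<open>(0, E, *)\<close>, \<open>(q, *, *)\<close>, with \<open>p\<close> and \<open>q\<close> nonzero since
  \<open>A x\<close> and \<open>A\<^sup>\<dagger> x\<close> are not both zero. So its rank exceeds that of \<open>E\<close> by two, while all of \<open>A\<close> outside the
  middle block lies in a single term \<open>z w\<^sup>\<dagger> + y z\<^sup>\<dagger>\<close>.\<close>

lemma isotropic_step:
  fixes A :: "complex mat"
  assumes A: "A \<in> carrier_mat (Suc m) (Suc m)"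
    and x: "x \<in> carrier_mat (Suc m) 1" "x \<noteq> 0\<^sub>m (Suc m) 1" and z: "z \<in> carrier_mat (Suc m) 1"
    and a: "a \<in> carrier_mat 1 1" and b: "b \<in> carrier_mat 1 1"
    and Ax: "A * x = z * a" and Bx: "A\<^sup>\<dagger> * x = z * b"
    and nz: "\<not> (A * x = 0\<^sub>m (Suc m) 1 \<and> A\<^sup>\<dagger> * x = 0\<^sub>m (Suc m) 1)"
    and zx: "(z\<^sup>\<dagger> * x) $$ (0,0) = 0"
    and IH: "\<And>A. A \<in> carrier_mat (m - 1) (m - 1) \<Longrightarrow> \<exists>k. star_sum (m - 1) k A \<and> has_minor (m - 1) k A"
  shows "\<exists>k. star_sum (Suc m) k A \<and> has_minor (Suc m) k A"
proof -
  let ?n = "Suc m"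
  have zx0: "z\<^sup>\<dagger> * x = 0\<^sub>m 1 1" using zx x z by (subst one_by_one_eq_zero_iff) auto
  have xz0: "x\<^sup>\<dagger> * z = 0\<^sub>m 1 1"
    using arg_cong[OF zx0, of mat_adjoint] x z by (simp add: mat_dims)
  have z0: "z \<noteq> 0\<^sub>m ?n 1" using nz Ax Bx a b by auto
  obtain W R g where W: "W \<in> carrier_mat ?n m" and R: "R \<in> carrier_mat m ?n"
    and g: "g \<in> carrier_mat 1 1" and one: "z * g * z\<^sup>\<dagger> + W * R = 1\<^sub>m ?n"
    and zW: "z\<^sup>\<dagger> * W = 0\<^sub>m 1 m"
    using complement_factorization[OF z z adjoint_mult_self_nonzero[OF z z0]] by metis
  have Wz: "W\<^sup>\<dagger> * z = 0\<^sub>m m 1"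
    using arg_cong[OF zW, of mat_adjoint] z W by (simp add: mat_dims)
  have xA: "x\<^sup>\<dagger> * A = b\<^sup>\<dagger> * z\<^sup>\<dagger>" and xB: "x\<^sup>\<dagger> * A\<^sup>\<dagger> = a\<^sup>\<dagger> * z\<^sup>\<dagger>"
    using arg_cong[OF Bx, of mat_adjoint] arg_cong[OF Ax, of mat_adjoint] A x z a b by (simp_all add: mat_dims)
  have xAW: "x\<^sup>\<dagger> * A * W = 0\<^sub>m 1 m" and xBW: "x\<^sup>\<dagger> * A\<^sup>\<dagger> * W = 0\<^sub>m 1 m"
    unfolding xA xB using z W a b by (simp_all add: mat_dims zW)
  have "W\<^sup>\<dagger> * A * x = W\<^sup>\<dagger> * z * a" "W\<^sup>\<dagger> * A\<^sup>\<dagger> * x = W\<^sup>\<dagger> * z * b"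
    using A W x z a b by (simp_all add: mat_dims Ax Bx)
  then have WAx: "W\<^sup>\<dagger> * A * x = 0\<^sub>m m 1" and WBx: "W\<^sup>\<dagger> * A\<^sup>\<dagger> * x = 0\<^sub>m m 1" using a b by (simp_all add: Wz)

  have x': "x = W * (R * x)"
  proof -
    have "x = (z * g * z\<^sup>\<dagger> + W * R) * x" unfolding one using x by simp
    also have "\<dots> = z * g * (z\<^sup>\<dagger> * x) + W * (R * x)" using x z g W R by (simp add: mat_dims)
    also have "\<dots> = W * (R * x)" unfolding zx0 using x z g W R by simp
    finally show ?thesis .
  qed
  let ?A = "W\<^sup>\<dagger> * A * W" and ?x = "R * x"
  have x0: "?x \<noteq> 0\<^sub>m m 1" using x x' W by (metis right_mult_zero_mat)
  have Ax1: "?A * ?x = 0\<^sub>m m 1" "?A\<^sup>\<dagger> * ?x = 0\<^sub>m m 1"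
  proof -
    have "?A * ?x = W\<^sup>\<dagger> * A * (W * (R * x))" "?A\<^sup>\<dagger> * ?x = W\<^sup>\<dagger> * A\<^sup>\<dagger> * (W * (R * x))"
      using A W R x by (simp_all add: mat_dims)
    then show "?A * ?x = 0\<^sub>m m 1" "?A\<^sup>\<dagger> * ?x = 0\<^sub>m m 1"
      unfolding x'[symmetric] WAx WBx by simp_all
  qed
  have "m \<noteq> 0"
  proof
    assume "m = 0"
    then have "?x = 0\<^sub>m m 1" using R x by (intro eq_matI) auto
    with x0 show False ..
  qed
  then obtain m' where m': "m = Suc m'" using not0_implies_Suc by blast
  obtain W' R' where W': "W' \<in> carrier_mat m m'" and R': "R' \<in> carrier_mat m' m"
    and A': "?A = R'\<^sup>\<dagger> * (W'\<^sup>\<dagger> * ?A * W') * R'"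
  proof (rule drop_kernel_vector[of ?A m' ?x])
    show "?A \<in> carrier_mat (Suc m') (Suc m')" "?x \<in> carrier_mat (Suc m') 1"
      using A W R x m' by auto
  qed (use x0 Ax1 m' in simp_all)
  obtain k where k: "star_sum m' k (W'\<^sup>\<dagger> * ?A * W')" "has_minor m' k (W'\<^sup>\<dagger> * ?A * W')"
    using IH[of "W'\<^sup>\<dagger> * ?A * W'"] A W W' m'
    by (metis adjoint_carrier mult_carrier_mat diff_Suc_1)
  have "star_sum m k ?A"
    using star_sum_pullback[OF k(1) R'] A' by simp
  then have core: "star_sum ?n k (R\<^sup>\<dagger> * ?A * R)" by (rule star_sum_pullback) (fact R)
  \<comment> \<open>Insert the adjoint of \<open>z g z\<^sup>\<dagger> + W R = 1\<close> on the left of \<open>A\<close>, then the identity itself on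
    the right of the part \<open>W\<^sup>\<dagger> A\<close>.\<close>
  define w where "w = A\<^sup>\<dagger> * z * g"
  define y where "y = R\<^sup>\<dagger> * (W\<^sup>\<dagger> * A * z) * g"
  have w: "w \<in> carrier_mat ?n 1" and y: "y \<in> carrier_mat ?n 1"
    using A z g W R unfolding w_def y_def by (auto intro!: mult_carrier_mat)
  have "W\<^sup>\<dagger> * A = W\<^sup>\<dagger> * A * (z * g * z\<^sup>\<dagger> + W * R)"
    unfolding one using A W by simp
  also have "\<dots> = W\<^sup>\<dagger> * A * z * g * z\<^sup>\<dagger> + ?A * R"
    using A z g W R by (simp add: mat_dims)
  finally have "R\<^sup>\<dagger> * (W\<^sup>\<dagger> * A) = R\<^sup>\<dagger> * (W\<^sup>\<dagger> * A * z * g * z\<^sup>\<dagger> + ?A * R)" by simp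
  also have "\<dots> = y * z\<^sup>\<dagger> + R\<^sup>\<dagger> * ?A * R"
    unfolding y_def using A z g W R by (simp add: mat_dims)
  finally have RWA: "R\<^sup>\<dagger> * (W\<^sup>\<dagger> * A) = y * z\<^sup>\<dagger> + R\<^sup>\<dagger> * ?A * R" .
  have "A = (z * g * z\<^sup>\<dagger> + W * R)\<^sup>\<dagger> * A"
    unfolding one using A by simp
  also have "\<dots> = z * w\<^sup>\<dagger> + R\<^sup>\<dagger> * (W\<^sup>\<dagger> * A)"
    unfolding w_def using A z g W R by (simp add: mat_dims)
  also have "\<dots> = z * w\<^sup>\<dagger> + y * z\<^sup>\<dagger> + R\<^sup>\<dagger> * ?A * R"
    unfolding RWA using z w y R W A by (intro assoc_add_mat[symmetric, of _ ?n ?n]) auto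
  also have "\<dots> = R\<^sup>\<dagger> * ?A * R + (z * w\<^sup>\<dagger> + y * z\<^sup>\<dagger>)"
    using z w y R W A by (intro comm_add_mat[of _ ?n ?n]) auto
  finally have expansion: "A = R\<^sup>\<dagger> * ?A * R + (z * w\<^sup>\<dagger> + y * z\<^sup>\<dagger>)" .
  have sum: "star_sum ?n (Suc (Suc k)) A"
    by (subst expansion) (intro star_sum.cross core z w y)

  have W2: "W * W' \<in> carrier_mat ?n m'" using W W' by simp
  have "has_minor m' k ((W * W')\<^sup>\<dagger> * A * (W * W'))"
    using k(2) A W W' by (simp add: mat_dims)
  from minor_of_compression[OF A W2 this]
  obtain P Q where P: "P \<in> carrier_mat k m'" and Q: "Q \<in> carrier_mat m' k"
    and d: "det (pencil (P * (W * W')\<^sup>\<dagger> * A * (W * W' * Q)) (P * (W * W')\<^sup>\<dagger> * A\<^sup>\<dagger> * (W * W' * Q))) \<noteq> 0"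
    by metis
  define P1 where "P1 = P * (W * W')\<^sup>\<dagger>"
  define Q1 where "Q1 = W * W' * Q"
  have P1: "P1 \<in> carrier_mat k ?n" and Q1: "Q1 \<in> carrier_mat ?n k" using P Q W2 by (auto simp: P1_def Q1_def)
  have xQ: "x\<^sup>\<dagger> * A * Q1 = 0\<^sub>m 1 k" "x\<^sup>\<dagger> * A\<^sup>\<dagger> * Q1 = 0\<^sub>m 1 k"
  proof -
    have "x\<^sup>\<dagger> * A * Q1 = x\<^sup>\<dagger> * A * W * (W' * Q)" "x\<^sup>\<dagger> * A\<^sup>\<dagger> * Q1 = x\<^sup>\<dagger> * A\<^sup>\<dagger> * W * (W' * Q)"
      using A x W W' Q by (simp_all add: Q1_def mat_dims)
    then show "x\<^sup>\<dagger> * A * Q1 = 0\<^sub>m 1 k" "x\<^sup>\<dagger> * A\<^sup>\<dagger> * Q1 = 0\<^sub>m 1 k"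
      unfolding xAW xBW using W' Q by simp_all
  qed
  have Px: "P1 * (A * x) = 0\<^sub>m k 1" "P1 * (A\<^sup>\<dagger> * x) = 0\<^sub>m k 1"
  proof -
    have "P1 * (A * x) = P * W'\<^sup>\<dagger> * (W\<^sup>\<dagger> * A * x)" "P1 * (A\<^sup>\<dagger> * x) = P * W'\<^sup>\<dagger> * (W\<^sup>\<dagger> * A\<^sup>\<dagger> * x)"
      using A x W W' P by (simp_all add: P1_def mat_dims)
    then show "P1 * (A * x) = 0\<^sub>m k 1" "P1 * (A\<^sup>\<dagger> * x) = 0\<^sub>m k 1"
      unfolding WAx WBx using W' P by simp_all
  qed
  have xx: "x\<^sup>\<dagger> * (A * x) = 0\<^sub>m 1 1" "x\<^sup>\<dagger> * (A\<^sup>\<dagger> * x) = 0\<^sub>m 1 1"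
  proof -
    have "x\<^sup>\<dagger> * (A * x) = x\<^sup>\<dagger> * z * a" "x\<^sup>\<dagger> * (A\<^sup>\<dagger> * x) = x\<^sup>\<dagger> * z * b"
      unfolding Ax Bx using x z a b by (simp_all add: mat_dims)
    then show "x\<^sup>\<dagger> * (A * x) = 0\<^sub>m 1 1" "x\<^sup>\<dagger> * (A\<^sup>\<dagger> * x) = 0\<^sub>m 1 1"
      unfolding xz0 using a b by simp_all
  qed
  \<comment> \<open>First the row \<open>x\<^sup>\<dagger>\<close> and the column \<open>z\<close>, then the row \<open>z\<^sup>\<dagger>\<close> and the column \<open>x\<close>:
    the order makes each bordering block triangular.\<close>
  define P2 where "P2 = stack_rows (x\<^sup>\<dagger>) P1"
  define Q2 where "Q2 = stack_cols z Q1"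
  have P2: "P2 \<in> carrier_mat (Suc k) ?n" and Q2: "Q2 \<in> carrier_mat ?n (Suc k)"
    using P1 Q1 by (auto simp: P2_def Q2_def)
  have P2x: "P2 * A * x = 0\<^sub>m (Suc k) 1" "P2 * A\<^sup>\<dagger> * x = 0\<^sub>m (Suc k) 1"
  proof -
    have "P2 * M * x = 0\<^sub>m (Suc k) 1" if M: "M \<in> carrier_mat ?n ?n"
      and "x\<^sup>\<dagger> * (M * x) = 0\<^sub>m 1 1" "P1 * (M * x) = 0\<^sub>m k 1" for M
    proof -
      have "P2 * M * x = P2 * (M * x)" using P2 M x by (simp add: mat_dims)
      also have "\<dots> = stack_rows (x\<^sup>\<dagger> * (M * x)) (P1 * (M * x))"
        unfolding P2_def using P1 M x by (intro stack_rows_mult[of _ ?n _ k _ 1]) auto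
      finally show ?thesis using that by simp
    qed
    from this[OF A xx(1) Px(1)] this[OF _ xx(2) Px(2)] A
    show "P2 * A * x = 0\<^sub>m (Suc k) 1" "P2 * A\<^sup>\<dagger> * x = 0\<^sub>m (Suc k) 1" by auto
  qed
  have zz: "(z\<^sup>\<dagger> * z) $$ (0,0) \<noteq> 0" by (rule adjoint_mult_self_nonzero[OF z z0])
  have ab: "a $$ (0,0) \<noteq> 0 \<or> b $$ (0,0) \<noteq> 0"
    using nz Ax Bx a b z one_by_one_eq_zero_iff[of a] one_by_one_eq_zero_iff[of b] by auto
  have c1: "(x\<^sup>\<dagger> * A * z) $$ (0,0) \<noteq> 0 \<or> (x\<^sup>\<dagger> * A\<^sup>\<dagger> * z) $$ (0,0) \<noteq> 0"
  proof -
    have "(x\<^sup>\<dagger> * A * z) $$ (0,0) = cnj (b $$ (0,0)) * (z\<^sup>\<dagger> * z) $$ (0,0)"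
      "(x\<^sup>\<dagger> * A\<^sup>\<dagger> * z) $$ (0,0) = cnj (a $$ (0,0)) * (z\<^sup>\<dagger> * z) $$ (0,0)"
      unfolding xA xB using a b z by (simp_all add: mat_dims) (simp_all add: scalar_prod_def One_nat_def)
    then show ?thesis using ab zz by auto
  qed
  have c2: "(z\<^sup>\<dagger> * A * x) $$ (0,0) \<noteq> 0 \<or> (z\<^sup>\<dagger> * A\<^sup>\<dagger> * x) $$ (0,0) \<noteq> 0"
  proof -
    have e: "z\<^sup>\<dagger> * A * x = z\<^sup>\<dagger> * z * a" "z\<^sup>\<dagger> * A\<^sup>\<dagger> * x = z\<^sup>\<dagger> * z * b"
      using A x z a b by (simp_all add: mat_dims Ax Bx)
    have "(z\<^sup>\<dagger> * z * a) $$ (0,0) = (z\<^sup>\<dagger> * z) $$ (0,0) * a $$ (0,0)"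
      "(z\<^sup>\<dagger> * z * b) $$ (0,0) = (z\<^sup>\<dagger> * z) $$ (0,0) * b $$ (0,0)"
      using a b z by (simp_all add: scalar_prod_def One_nat_def)
    then show ?thesis unfolding e using ab zz by auto
  qed
  have "det (pencil (stack_rows (z\<^sup>\<dagger>) P2 * A * stack_cols x Q2) (stack_rows (z\<^sup>\<dagger>) P2 * A\<^sup>\<dagger> * stack_cols x Q2))
    = [:(z\<^sup>\<dagger> * A * x) $$ (0,0), (z\<^sup>\<dagger> * A\<^sup>\<dagger> * x) $$ (0,0):] * det (pencil (P2 * A * Q2) (P2 * A\<^sup>\<dagger> * Q2))"
    using A P2 Q2 x z P2x by (intro det_pencil_border[of _ ?n _ _ "Suc k"] disjI2) auto
  also have "det (pencil (P2 * A * Q2) (P2 * A\<^sup>\<dagger> * Q2))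
    = [:(x\<^sup>\<dagger> * A * z) $$ (0,0), (x\<^sup>\<dagger> * A\<^sup>\<dagger> * z) $$ (0,0):] * det (pencil (P1 * A * Q1) (P1 * A\<^sup>\<dagger> * Q1))"
    unfolding P2_def Q2_def
    using A P1 Q1 x z xQ by (intro det_pencil_border[of _ ?n _ _ k] disjI1) auto
  finally have "det (pencil (stack_rows (z\<^sup>\<dagger>) P2 * A * stack_cols x Q2) (stack_rows (z\<^sup>\<dagger>) P2 * A\<^sup>\<dagger> * stack_cols x Q2)) \<noteq> 0"
    using c1 c2 d unfolding P1_def Q1_def by (auto simp del: mult_pCons_left mult_pCons_right)
  then have "has_minor ?n (Suc (Suc k)) A"
    unfolding has_minor_def using P2 Q2 stack_carrier by metis
  with sum show ?thesis by blast
qed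

lemma expansion_with_minor:
  "A \<in> carrier_mat n n \<Longrightarrow> \<exists>k. star_sum n k A \<and> has_minor n k A"
proof (induction n arbitrary: A rule: less_induct)
  case (less n)
  show ?case
  proof (cases n)
    case 0
    have "A = 0\<^sub>m 0 0" using less.prems 0 by (intro eq_matI) auto
    moreover have "has_minor 0 0 A"
      unfolding has_minor_def using less.prems 0 by (intro bexI[of _ "0\<^sub>m 0 0"]) auto
    ultimately show ?thesis using star_sum.zero[of 0] 0 by auto
  next
    case (Suc m)
    have A: "A \<in> carrier_mat (Suc m) (Suc m)" using less.prems Suc by simp
    have IH: "\<exists>k. star_sum i k C \<and> has_minor i k C" if "C \<in> carrier_mat i i" "i \<le> m" for i C
      using less.IH[of i C] that Suc by simp
    obtain x z a b where x: "x \<in> carrier_mat (Suc m) 1" "x \<noteq> 0\<^sub>m (Suc m) 1" and z: "z \<in> carrier_mat (Suc m) 1"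
      and ab: "a \<in> carrier_mat 1 1" "b \<in> carrier_mat 1 1" and par: "A * x = z * a" "A\<^sup>\<dagger> * x = z * b"
      using pencil_eigenvector[OF A adjoint_carrier[OF A]] by (metis zero_less_Suc)
    show ?thesis
    proof (cases "A * x = 0\<^sub>m (Suc m) 1 \<and> A\<^sup>\<dagger> * x = 0\<^sub>m (Suc m) 1")
      case True
      then obtain W R where W: "W \<in> carrier_mat (Suc m) m" and R: "R \<in> carrier_mat m (Suc m)"
        and eq: "A = R\<^sup>\<dagger> * (W\<^sup>\<dagger> * A * W) * R"
        using drop_kernel_vector[OF A x] by metis
      obtain k where k: "star_sum m k (W\<^sup>\<dagger> * A * W)" "has_minor m k (W\<^sup>\<dagger> * A * W)"
        using IH[of "W\<^sup>\<dagger> * A * W" m] A W by (metis adjoint_carrier mult_carrier_mat order_refl)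
      then show ?thesis
        using star_sum_pullback[OF k(1) R] has_minor_compression[OF A W k(2)] eq Suc by auto
    next
      case False
      then show ?thesis
        using nonisotropic_step[OF A x(1) z ab par] isotropic_step[OF A x z ab par] IH Suc
        by (metis diff_le_self order_refl)
    qed
  qed
qed

section \<open>Reading off the decomposition of the pencil\<close>

lemma finsum_mat_entries:
  fixes F :: "'b \<Rightarrow> 'a :: comm_ring_1 mat"
  assumes "finite I" and "\<And>p. p \<in> I \<Longrightarrow> F p \<in> carrier_mat n m"
  shows "finsum (module_mat TYPE('a) n m) F I = mat n m (\<lambda>(i, j). \<Sum>p\<in>I. F p $$ (i, j))"
proof -
  interpret abelian_group "module_mat TYPE('a) n m" by (rule abelian_group_mat)
  show ?thesis using assms
  proof (induction I rule: finite_induct)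
    case empty
    then show ?case by (auto simp: module_mat_simps intro!: eq_matI)
  next
    case (insert p I)
    then show ?case by (subst finsum_insert) (auto simp: module_mat_simps intro!: eq_matI)
  qed
qed

lemma pCons_sum:
  "(\<Sum>p\<in>I. [:f p, g p:]) = [:\<Sum>p\<in>I. f p, \<Sum>p\<in>I. g p:]"
  by (induction I rule: infinite_finite_induct) auto

lemma map_poly_cnj_linear: "map_poly cnj [:a, b:] = [:cnj a, cnj b:]"
  by (rule poly_eqI) (simp add: coeff_map_poly coeff_pCons split: nat.split)

lemma vec_degree_le:
  assumes "\<And>i. i < dim_vec v \<Longrightarrow> degree (v $ i) \<le> d"
  shows "vec_degree v \<le> d"
  using assms by (auto simp: vec_degree_def)

theorem theorem13:
  fixes A B :: "complex mat" and n r :: nat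
  assumes "A \<in> carrier_mat n n" and "B \<in> carrier_mat n n"
    and "star_palindromic A B"
    and "normal_rank (pencil A B) = r" and "r \<le> n"
  shows "\<exists>(l::nat) (s::nat) (a::nat \<Rightarrow> real) (b::nat \<Rightarrow> real)
      (u::nat \<Rightarrow> complex poly vec) (v::nat \<Rightarrow> complex poly vec) (w::nat \<Rightarrow> complex poly vec).
    (\<forall>i\<in>{1..l}. u i \<in> carrier_vec n) \<and>
    (\<forall>j\<in>{1..s}. v j \<in> carrier_vec n \<and> w j \<in> carrier_vec n) \<and>
    pencil A B =
      (\<Oplus>\<^bsub>module_mat TYPE(complex poly) n n\<^esub> i \<in> {1..l}.
         [:complex_of_real (a i) - complex_of_real (b i) * \<i>,
           complex_of_real (a i) + complex_of_real (b i) * \<i>:] \<cdot>\<^sub>m outer_star (u i) (u i))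
      + (\<Oplus>\<^bsub>module_mat TYPE(complex poly) n n\<^esub> j \<in> {1..s}. outer_star (v j) (w j))
      + (\<Oplus>\<^bsub>module_mat TYPE(complex poly) n n\<^esub> j \<in> {1..s}. outer_star (rev_vec (w j)) (v j)) \<and>
    l + 2 * s = r \<and>
    (\<forall>i\<in>{1..l}. vec_degree (u i) = 0) \<and>
    (\<forall>j\<in>{1..s}. vec_degree (v j) = 0 \<and> vec_degree (w j) \<le> 1)"
proof -
  have B: "B = A\<^sup>\<dagger>" using assms(3) by (simp add: star_palindromic_def)
  obtain k where k: "star_sum n k A" "has_minor n k A"
    using expansion_with_minor[OF assms(1)] by auto
  \<comment> \<open>Zero terms fill up the weight from \<open>k\<close> to \<open>r\<close>.\<close>
  have "k \<le> r" using minor_le_normal_rank[OF assms(1) k(2)] assms(4) B by simp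
  then have "star_sum n r A" by (rule star_sum_pad[OF k(1)])
  then obtain l s c u v x y where ls: "l + 2 * s = r"
    and e: "\<And>i j. i < n \<Longrightarrow> j < n \<Longrightarrow> A $$ (i, j) = (\<Sum>p=1..l. c p * u p i * cnj (u p j))
      + (\<Sum>q=1..s. v q i * cnj (x q j)) + (\<Sum>q=1..s. y q i * cnj (v q j))"
    by (rule star_sum_entries) blast
  define U where "U = (\<lambda>p. vec n (\<lambda>i. [:u p i:]))"
  define V where "V = (\<lambda>q. vec n (\<lambda>i. [:v q i:]))"
  define W where "W = (\<lambda>q. vec n (\<lambda>i. [:x q i, y q i:]))"
  have a: "complex_of_real (Re (c p)) - complex_of_real (- Im (c p)) * \<i> = c p"
     "complex_of_real (Re (c p)) + complex_of_real (- Im (c p)) * \<i> = cnj (c p)" for p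
    by (auto simp: complex_eq_iff)
  have UU: "outer_star (U p) (U p) = mat n n (\<lambda>(i, j). [:u p i * cnj (u p j):])" for p
    by (rule eq_matI) (auto simp: outer_star_def vec_star_def U_def map_poly_pCons)
  have VW: "outer_star (V q) (W q) = mat n n (\<lambda>(i, j). [:v q i * cnj (x q j), v q i * cnj (y q j):])" for q
    by (rule eq_matI) (auto simp: outer_star_def vec_star_def V_def W_def map_poly_cnj_linear map_poly_pCons)
  have WV: "outer_star (rev_vec (W q)) (V q) = mat n n (\<lambda>(i, j). [:y q i * cnj (v q j), x q i * cnj (v q j):])" for q
    by (rule eq_matI) (auto simp: outer_star_def vec_star_def rev_vec_def V_def W_def map_poly_cnj_linear map_poly_pCons One_nat_def)
  have "pencil A B =
      (\<Oplus>\<^bsub>module_mat TYPE(complex poly) n n\<^esub> i \<in> {1..l}. [:c i, cnj (c i):] \<cdot>\<^sub>m outer_star (U i) (U i))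
      + (\<Oplus>\<^bsub>module_mat TYPE(complex poly) n n\<^esub> j \<in> {1..s}. outer_star (V j) (W j))
      + (\<Oplus>\<^bsub>module_mat TYPE(complex poly) n n\<^esub> j \<in> {1..s}. outer_star (rev_vec (W j)) (V j))"
    unfolding UU VW WV
  proof (subst (1 2 3) finsum_mat_entries, simp_all, rule eq_matI, goal_cases)
    case (1 i j)
    then have "B $$ (i, j) = cnj (A $$ (j, i))" using assms(1) B by simp
    with 1 show ?case using assms(1)
      by (simp add: e pCons_sum mult_ac add_ac)
  qed (use assms(1) in auto)
  moreover have "\<forall>i\<in>{1..l}. vec_degree (U i) = 0"
    using vec_degree_le[of "U _" 0] by (auto simp: U_def)
  moreover have "vec_degree (V j) = 0" "vec_degree (W j) \<le> 1" for j
    using vec_degree_le[of "V j" 0] vec_degree_le[of "W j" 1] by (auto simp: V_def W_def)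
  ultimately show ?thesis
    using ls
    by (intro exI[of _ l] exI[of _ s] exI[of _ "\<lambda>p. Re (c p)"] exI[of _ "\<lambda>p. - Im (c p)"]
       exI[of _ U] exI[of _ V] exI[of _ W]) (simp only: a, simp add: U_def V_def W_def)
qed

end
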